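(* Let $\alpha,\beta\in\mathbb{C}$. The matrix $$\left(1,\ \frac{x}{1-\beta x}\right)^{-1}\cdot\left(\frac{1-\beta x}{1+\alpha x},\ \frac{x(1-\beta x)}{1+\alpha x}\right)$$ is the coefficient array of the family of orthogonal polynomials $(\tilde P_n(x))_{n\ge 0}$ that satisfies $\tilde P_0(x)=1$, $\tilde P_1(x)=x-(\alpha+\beta)$ and the three-term recurrence $$\tilde P_n(x)=(x-(\alpha+2\beta))\tilde P_{n-1}(x)-\beta(\alpha+\beta)\tilde P_{n-2}(x),\qquad n\ge 2.$$
   Context: For formal power series $g(x)=1+g_1x+\cdots$ and $f(x)=x+f_2x^2+\cdots$, the Riordan array $(g,f)$ is the infinite lower-triangular matrix (indices from $0$) whose $(n,k)$ entry is $[x^n]\,g(x)f(x)^k$. Matrix multiplication of Riordan arrays is given by $(g,f)\cdot(h,l)=(g\cdot(h\circ f),\,l\circ f)$; the identity is $(1,x)$ and the inverse is $(g,f)^{-1}=(1/(g\circ\bar f),\bar f)$, where $\bar f$ is the compositional inverse of $f$. The coefficient array of polynomials $P_n(x)=\sum_{k=0}^n d_{n,k}x^k$ is the matrix $(d_{n,k})_{n,k\ge 0}$. Orthogonal polynomials are understood through their three-term recurrence: a family $(P_n)$ with $P_{-1}=0$, $P_0=1$ is a family of orthogonal polynomials if there are sequences $\alpha_n,\beta_n$ with $P_n(x)=(x-\alpha_n)P_{n-1}(x)-\beta_nP_{n-2}(x)$ for $n\ge 1$. *)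

theory Defs
  imports Complex_Main "HOL-Computational_Algebra.Computational_Algebra"
begin

type_synonym 'a infmat = "nat \<Rightarrow> nat \<Rightarrow> 'a"

definition lower_triangular :: "'a::zero infmat \<Rightarrow> bool" where
  "lower_triangular A \<longleftrightarrow> (\<forall>n k. n < k \<longrightarrow> A n k = 0)"

definition infmat_one :: "'a::zero_neq_one infmat" where
  "infmat_one = (\<lambda>n k. if n = k then 1 else 0)"

text \<open>For lower triangular \<open>A\<close> the terms with \<open>j > n\<close> vanish, so this is the full row-by-column sum.\<close>

definition infmat_mult :: "'a::comm_ring_1 infmat \<Rightarrow> 'a infmat \<Rightarrow> 'a infmat"
    (infixl "\<odot>" 70) where
  "A \<odot> B = (\<lambda>n k. \<Sum>j\<le>n. A n j * B j k)"

text \<open>The inverse in the monoid of lower triangular matrices; it is unspecified for matrices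
  that are not invertible there.\<close>

definition infmat_inv :: "'a::comm_ring_1 infmat \<Rightarrow> 'a infmat" where
  "infmat_inv A = (THE B. lower_triangular B \<and> A \<odot> B = infmat_one \<and> B \<odot> A = infmat_one)"

definition riordan_pair :: "'a::comm_ring_1 fps \<Rightarrow> 'a fps \<Rightarrow> bool" where
  "riordan_pair g f \<longleftrightarrow> fps_nth g 0 = 1 \<and> fps_nth f 0 = 0 \<and> fps_nth f 1 = 1"

definition riordan :: "'a::comm_ring_1 fps \<Rightarrow> 'a fps \<Rightarrow> 'a infmat" where
  "riordan g f = (\<lambda>n k. fps_nth (g * f ^ k) n)"

definition is_coefficient_array :: "'a::comm_ring_1 infmat \<Rightarrow> (nat \<Rightarrow> 'a poly) \<Rightarrow> bool" where
  "is_coefficient_array D P \<longleftrightarrow>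
     lower_triangular D \<and> (\<forall>n. P n = (\<Sum>k\<le>n. monom (D n k) k))"

text \<open>The conditional supplies the convention \<open>P\<^sub>-\<^sub>1 = 0\<close>: for \<open>n = 1\<close>
  truncated subtraction would turn \<open>P (n - 2)\<close> into \<open>P 0\<close>.\<close>

definition orthogonal_family :: "(nat \<Rightarrow> 'a::comm_ring_1 poly) \<Rightarrow> bool" where
  "orthogonal_family P \<longleftrightarrow> P 0 = 1 \<and>
     (\<exists>a b. \<forall>n\<ge>1. P n = [:- a n, 1:] * P (n - 1)
                       - smult (b n) (if n = 1 then 0 else P (n - 2)))"

lemma lower_triangular_riordan:
  assumes "fps_nth f 0 = 0"
  shows "lower_triangular (riordan g f)"
proof -
  have "fps_nth (g * f ^ k) n = 0" if "n < k" for n k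
    unfolding fps_mult_nth
    by (rule sum.neutral) (use that startsby_zero_power_prefix[OF assms] in auto)
  then show ?thesis by (simp add: lower_triangular_def riordan_def)
qed

lemma riordan_one: "riordan 1 fps_X = (infmat_one :: 'a::comm_ring_1 infmat)"
  by (auto simp: riordan_def infmat_one_def fun_eq_iff)

lemma riordan_mult:
  fixes g f h l :: "'a::field fps"
  assumes f0: "fps_nth f 0 = 0"
  shows "riordan g f \<odot> riordan h l = riordan (g * (h oo f)) (l oo f)"
proof (intro ext)
  fix n k
  let ?a = "h * l ^ k"
  have pre: "fps_nth (f ^ j) i = 0" if "i < j" for i j
    using that startsby_zero_power_prefix[OF f0] by auto
  have "riordan (g * (h oo f)) (l oo f) n k = fps_nth (g * (?a oo f)) n"
    by (simp add: riordan_def fps_compose_mult_distrib[OF f0] fps_compose_power[OF f0] mult.assoc)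
  also have "\<dots> = (\<Sum>i=0..n. fps_nth g i * (\<Sum>j=0..n. fps_nth ?a j * fps_nth (f ^ j) (n - i)))"
    unfolding fps_mult_nth[of g] fps_compose_nth
    by (intro sum.cong refl arg_cong2[where f="(*)"] sum.mono_neutral_left) (auto simp: pre)
  also have "\<dots> = (\<Sum>j=0..n. \<Sum>i=0..n. fps_nth g i * fps_nth (f ^ j) (n - i) * fps_nth ?a j)"
    by (subst sum.swap) (simp add: sum_distrib_left mult_ac)
  also have "\<dots> = (\<Sum>j=0..n. fps_nth (g * f ^ j) n * fps_nth ?a j)"
    by (simp add: fps_mult_nth[of g] sum_distrib_right)
  also have "\<dots> = (riordan g f \<odot> riordan h l) n k"
    by (simp add: riordan_def infmat_mult_def atMost_atLeast0)
  finally show "(riordan g f \<odot> riordan h l) n k = riordan (g * (h oo f)) (l oo f) n k" ..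
qed

lemma infmat_mult_assoc:
  assumes "lower_triangular A" "lower_triangular B"
  shows "(A \<odot> B) \<odot> C = A \<odot> (B \<odot> C)"
proof (intro ext)
  fix n k
  have "((A \<odot> B) \<odot> C) n k = (\<Sum>i\<le>n. A n i * (\<Sum>j\<le>n. B i j * C j k))"
    unfolding infmat_mult_def sum_distrib_right sum_distrib_left
    by (subst sum.swap) (simp add: mult_ac)
  also have "\<dots> = (\<Sum>i\<le>n. A n i * (\<Sum>j\<le>i. B i j * C j k))"
    using assms(2) unfolding lower_triangular_def
    by (intro sum.cong refl arg_cong2[where f="(*)"] sum.mono_neutral_right) auto
  finally show "((A \<odot> B) \<odot> C) n k = (A \<odot> (B \<odot> C)) n k" by (simp add: infmat_mult_def)
qed

lemma infmat_one_mult: "infmat_one \<odot> A = A"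
proof (intro ext)
  fix n k
  have "(infmat_one \<odot> A) n k = (\<Sum>j\<le>n. if n = j then A j k else 0)"
    unfolding infmat_mult_def infmat_one_def by (intro sum.cong) auto
  then show "(infmat_one \<odot> A) n k = A n k" by simp
qed

lemma infmat_mult_one:
  assumes "lower_triangular A" shows "A \<odot> infmat_one = A"
proof (intro ext)
  fix n k
  have "(A \<odot> infmat_one) n k = (\<Sum>j\<le>n. if j = k then A n j else 0)"
    unfolding infmat_mult_def infmat_one_def by (intro sum.cong) auto
  then show "(A \<odot> infmat_one) n k = A n k"
    using assms by (auto simp: lower_triangular_def)
qed

lemma infmat_inv_eqI:
  assumes "lower_triangular A" "lower_triangular B" "A \<odot> B = infmat_one" "B \<odot> A = infmat_one"
  shows "infmat_inv A = B"
  unfolding infmat_inv_def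
proof (rule the_equality)
  fix C assume C: "lower_triangular C \<and> A \<odot> C = infmat_one \<and> C \<odot> A = infmat_one"
  have "C = (B \<odot> A) \<odot> C" by (simp add: assms(4) infmat_one_mult)
  also have "\<dots> = B \<odot> (A \<odot> C)" by (rule infmat_mult_assoc[OF assms(2,1)])
  also have "\<dots> = B" using C infmat_mult_one[OF assms(2)] by simp
  finally show "C = B" .
qed (use assms in auto)

lemma riordan_inv:
  fixes g f :: "'a::field fps"
  assumes "riordan_pair g f"
  shows "infmat_inv (riordan g f) = riordan (inverse (g oo fps_inv f)) (fps_inv f)"
proof -
  from assms have g0: "fps_nth g 0 = 1" and f0: "fps_nth f 0 = 0" and f1: "fps_nth f 1 \<noteq> 0"
    by (auto simp: riordan_pair_def)
  have i0: "fps_nth (fps_inv f) 0 = 0" by (simp add: fps_inv_def)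
  have u: "fps_nth (g oo fps_inv f) 0 \<noteq> 0" by (simp add: g0)
  have "(g oo fps_inv f) oo f = g oo (fps_inv f oo f)"
    by (rule fps_compose_assoc[OF f0 i0, symmetric])
  then have "inverse (g oo fps_inv f) oo f = inverse g"
    using fps_inverse_compose[OF f0 u] by (simp add: fps_inv[OF f0 f1])
  then have 1: "riordan g f \<odot> riordan (inverse (g oo fps_inv f)) (fps_inv f) = infmat_one"
    using g0 by (simp add: riordan_mult[OF f0] fps_inv[OF f0 f1] inverse_mult_eq_1' riordan_one)
  have 2: "riordan (inverse (g oo fps_inv f)) (fps_inv f) \<odot> riordan g f = infmat_one"
    using u by (simp add: riordan_mult[OF i0] fps_inv_right[OF f0 f1] inverse_mult_eq_1 riordan_one)
  show ?thesis
    by (rule infmat_inv_eqI[OF lower_triangular_riordan[OF f0] lower_triangular_riordan[OF i0] 1 2])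
qed

end

theory Submission
  imports Defs
begin

text \<open>
  The series \<open>x / (1 - c x)\<close> form a one-parameter group under composition, since in the variable
  \<open>1 / x\<close> they are the translations by \<open>- c\<close>. The left-hand inverse is therefore the Riordan array
  of \<open>1\<close> and \<open>x / (1 + \<beta> x)\<close>, and multiplying by it substitutes \<open>y = x / (1 + \<beta> x)\<close> in the second
  array. There \<open>1 - \<beta> y = 1 / (1 + \<beta> x)\<close> and \<open>1 + \<alpha> y = (1 + (\<alpha> + \<beta>) x) / (1 + \<beta> x)\<close>, so the product
  is the Riordan array \<open>(G, F)\<close> with
  \<open>G = 1 / (1 + (\<alpha> + \<beta>) x)\<close> and \<open>F = x / ((1 + \<beta> x) (1 + (\<alpha> + \<beta>) x))\<close>.

  Writing \<open>D = 1 + (\<alpha> + 2 \<beta>) x + \<beta> (\<alpha> + \<beta>) x\<^sup>2\<close> for the denominator of \<open>F\<close>, one has \<open>D F = x\<close>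
  and \<open>D G = 1 + \<beta> x\<close>. Comparing coefficients of \<open>x\<^sup>n\<close> in \<open>D (G F\<^sup>k) = x (G F\<^sup>k\<^sup>-\<^sup>1)\<close> gives the
  three-term recurrence in every column \<open>k \<ge> 1\<close>, and column \<open>0\<close> obeys it from \<open>n = 2\<close> on because
  \<open>D G\<close> has degree at most 1. The linear term \<open>\<beta> x\<close> of \<open>D G\<close> is what shifts the first coefficient
  from \<open>\<alpha> + 2 \<beta>\<close> to \<open>\<alpha> + \<beta>\<close>. The group law is \<open>moebius_compose_moebius\<close>, the substitution
  \<open>moebius_substitution\<close>, and the recurrence \<open>row_polynomials_three_term\<close>.
\<close>

definition row_poly :: "'a::comm_ring_1 infmat \<Rightarrow> nat \<Rightarrow> 'a poly" where
  "row_poly A n = (\<Sum>k\<le>n. monom (A n k) k)"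

lemma coeff_row_poly:
  assumes "lower_triangular A"
  shows "coeff (row_poly A n) k = A n k"
  using assms by (auto simp: row_poly_def coeff_sum lower_triangular_def)

lemma fps_nth_quadratic_mult:
  fixes H :: "'a::comm_ring_1 fps"
  shows "fps_nth ((1 + fps_const a * fps_X + fps_const b * fps_X^2) * H) (Suc (Suc n)) =
         fps_nth H (Suc (Suc n)) + a * fps_nth H (Suc n) + b * fps_nth H n"
  by (simp add: distrib_right mult.assoc power2_eq_square)

text \<open>
  Multiplication by the quadratic denominator of \<open>F\<close> lowers the power of \<open>F\<close> by one, which on row
  polynomials is multiplication by the variable. Column \<open>0\<close> has no column to its left; there the
  numerator \<open>1 + u x\<close> of \<open>G\<close> enters, and it is invisible in degree at least 2.
\<close>

lemma row_polynomials_three_term: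
  fixes F G :: "'a::comm_ring_1 fps"
  assumes F: "(1 + fps_const a * fps_X + fps_const b * fps_X^2) * F = fps_X"
    and G: "(1 + fps_const a * fps_X + fps_const b * fps_X^2) * G = 1 + fps_const u * fps_X"
  shows "lower_triangular (riordan G F)"
    and "row_poly (riordan G F) 0 = 1"
    and "row_poly (riordan G F) 1 = [:u - a, 1:]"
    and "row_poly (riordan G F) (Suc (Suc n)) =
         [:- a, 1:] * row_poly (riordan G F) (Suc n) - smult b (row_poly (riordan G F) n)"
proof -
  let ?D = "1 + fps_const a * fps_X + fps_const b * fps_X^2"
  have D0: "fps_nth (?D * H) 0 = fps_nth H 0" for H
    by (simp add: power2_eq_square)
  have D1: "fps_nth (?D * H) 1 = fps_nth H 1 + a * fps_nth H 0" for H
    by (simp add: distrib_right mult.assoc power2_eq_square)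
  have F0: "fps_nth F 0 = 0" using D0[of F] F by simp
  have F1: "fps_nth F 1 = 1" using D1[of F] F F0 by simp
  have G0: "fps_nth G 0 = 1" using D0[of G] G by simp
  have G1: "fps_nth G 1 = u - a" using D1[of G] G G0 by (simp add: eq_diff_eq)
  show lt: "lower_triangular (riordan G F)"
    by (rule lower_triangular_riordan[OF F0])
  show "row_poly (riordan G F) 0 = 1"
    by (simp add: row_poly_def riordan_def G0)
  have "fps_nth (G * F) 1 = 1"
    using F0 F1 G0 by (simp add: fps_mult_nth)
  then show "row_poly (riordan G F) 1 = [:u - a, 1:]"
    using G1 by (simp add: row_poly_def riordan_def monom_0 monom_Suc)
  show "row_poly (riordan G F) (Suc (Suc n)) =
        [:- a, 1:] * row_poly (riordan G F) (Suc n) - smult b (row_poly (riordan G F) n)"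
  proof (rule poly_eqI)
    fix k
    have row: "coeff (row_poly (riordan G F) m) j = fps_nth (G * F ^ j) m" for m j
      by (simp only: coeff_row_poly[OF lt]) (simp only: riordan_def)
    have rec: "fps_nth (G * F ^ k) (Suc (Suc n)) =
               fps_nth (?D * (G * F ^ k)) (Suc (Suc n)) - a * fps_nth (G * F ^ k) (Suc n)
               - b * fps_nth (G * F ^ k) n"
      by (simp add: fps_nth_quadratic_mult)
    have "fps_nth (?D * (G * F ^ k)) (Suc (Suc n)) =
          (case k of 0 \<Rightarrow> 0 | Suc j \<Rightarrow> fps_nth (G * F ^ j) (Suc n))"
    proof (cases k)
      case 0
      then show ?thesis by (simp add: G)
    next
      case (Suc j)
      have "?D * (G * F ^ k) = (?D * F) * (G * F ^ j)"
        by (simp only: Suc power_Suc mult_ac)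
      also have "\<dots> = fps_X * (G * F ^ j)"
        by (simp only: F)
      finally show ?thesis by (simp add: Suc)
    qed
    with rec show "coeff (row_poly (riordan G F) (Suc (Suc n))) k =
        coeff ([:- a, 1:] * row_poly (riordan G F) (Suc n) - smult b (row_poly (riordan G F) n)) k"
      by (simp add: row coeff_pCons split: nat.splits)
  qed
qed

lemma fps_one_minus_linear_compose:
  fixes h :: "'a::field fps"
  assumes "fps_nth h 0 = 0"
  shows "(1 - fps_const c * fps_X) oo h = 1 - fps_const c * h"
  using assms by (simp add: fps_compose_sub_distrib fps_compose_mult_distrib)

lemma fps_mult_divide_cancel:
  fixes u v :: "'a::field fps"
  assumes "fps_nth v 0 \<noteq> 0"
  shows "u / v * v = u"
  using assms by (simp add: fps_divide_unit mult.assoc inverse_mult_eq_1)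

lemma fps_eq_divideI:
  fixes u v w :: "'a::field fps"
  assumes "fps_nth v 0 \<noteq> 0" and "w * v = u"
  shows "w = u / v"
  using assms by (auto simp: fps_divide_unit mult.assoc inverse_mult_eq_1')

lemma moebius_compose_moebius:
  fixes c d :: "'a::field"
  shows "(fps_X / (1 - fps_const c * fps_X)) oo (fps_X / (1 - fps_const d * fps_X)) =
         fps_X / (1 - fps_const (c + d) * fps_X)"
proof -
  define h :: "'a fps" where "h = fps_X / (1 - fps_const d * fps_X)"
  have h0: "fps_nth h 0 = 0" by (simp add: h_def fps_divide_unit)
  have h: "h * (1 - fps_const d * fps_X) = fps_X"
    unfolding h_def by (rule fps_mult_divide_cancel) simp
  define w where "w = (fps_X / (1 - fps_const c * fps_X)) oo h"
  have "w * ((1 - fps_const c * fps_X) oo h) = fps_X oo h"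
    unfolding w_def fps_compose_mult_distrib[OF h0, symmetric]
    by (subst fps_mult_divide_cancel) auto
  then have w: "w * (1 - fps_const c * h) = h"
    by (simp add: fps_one_minus_linear_compose[OF h0] h0)
  \<comment> \<open>Clearing the denominator of \<open>h\<close> turns the factor \<open>1 - c h\<close> into \<open>1 - (c + d) x\<close>.\<close>
  have "w * ((1 - fps_const d * fps_X) - fps_const c * (h * (1 - fps_const d * fps_X))) =
        w * (1 - fps_const c * h) * (1 - fps_const d * fps_X)"
    by (simp add: algebra_simps del: fps_const_mult)
  also have "\<dots> = fps_X"
    by (simp only: w h)
  finally have "w * (1 - fps_const (c + d) * fps_X) = fps_X"
    by (simp only: h fps_const_add[symmetric]) (simp add: algebra_simps del: fps_const_add)
  then show ?thesis
    unfolding w_def h_def by (intro fps_eq_divideI) auto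
qed

lemma infmat_inv_riordan_moebius:
  fixes c :: "'a::field"
  shows "infmat_inv (riordan 1 (fps_X / (1 - fps_const c * fps_X))) =
         riordan 1 (fps_X / (1 - fps_const (- c) * fps_X))"
proof -
  have 0: "fps_nth (fps_X / (1 - fps_const d * fps_X)) 0 = 0" for d :: 'a
    by (simp add: fps_divide_unit)
  have cancel: "riordan 1 (fps_X / (1 - fps_const d * fps_X)) \<odot>
      riordan 1 (fps_X / (1 - fps_const e * fps_X)) = infmat_one" if "e + d = 0" for d e :: 'a
    by (simp only: riordan_mult[OF 0] moebius_compose_moebius that) (simp add: riordan_one)
  show ?thesis
    by (intro infmat_inv_eqI lower_triangular_riordan 0 cancel) simp_all
qed

text \<open>
  The two factors of the quadratic denominator are kept apart here: \<open>1 + \<beta> x\<close> comes from the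
  substituted series, \<open>1 + (\<alpha> + \<beta>) x\<close> from its image under \<open>1 + \<alpha> y\<close>.
\<close>

lemma moebius_substitution:
  fixes \<alpha> \<beta> :: "'a::field"
  defines "h \<equiv> fps_X / (1 - fps_const (- \<beta>) * fps_X)"
  defines "q \<equiv> (1 - fps_const \<beta> * fps_X) / (1 + fps_const \<alpha> * fps_X)"
  shows "(q oo h) * (1 + fps_const (\<alpha> + \<beta>) * fps_X) = 1"
    and "((fps_X * (1 - fps_const \<beta> * fps_X) / (1 + fps_const \<alpha> * fps_X)) oo h) *
         ((1 + fps_const \<beta> * fps_X) * (1 + fps_const (\<alpha> + \<beta>) * fps_X)) = fps_X"
proof -
  let ?B = "1 + fps_const \<beta> * fps_X" and ?A = "1 + fps_const (\<alpha> + \<beta>) * fps_X"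
  have h0: "fps_nth h 0 = 0" by (simp add: h_def fps_divide_unit)
  have h: "h * ?B = fps_X"
    using fps_mult_divide_cancel[of "1 - fps_const (- \<beta>) * fps_X" fps_X]
    by (simp add: h_def flip: fps_const_neg)
  have "q * (1 - fps_const (- \<alpha>) * fps_X) = 1 - fps_const \<beta> * fps_X"
    using fps_mult_divide_cancel[of "1 + fps_const \<alpha> * fps_X" "1 - fps_const \<beta> * fps_X"]
    by (simp add: q_def flip: fps_const_neg)
  from arg_cong[OF this, of "\<lambda>s. s oo h"]
  have qh: "(q oo h) * (1 - fps_const (- \<alpha>) * h) = 1 - fps_const \<beta> * h"
    by (simp only: fps_compose_mult_distrib[OF h0] fps_one_minus_linear_compose[OF h0])
  have "(q oo h) * (?B + fps_const \<alpha> * (h * ?B)) = (q oo h) * (1 - fps_const (- \<alpha>) * h) * ?B"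
    by (simp add: algebra_simps del: fps_const_mult flip: fps_const_neg)
  also have "\<dots> = ?B - fps_const \<beta> * (h * ?B)"
    by (simp only: qh left_diff_distrib mult_1_left mult.assoc)
  finally have "(q oo h) * (?B + fps_const \<alpha> * (h * ?B)) = ?B - fps_const \<beta> * (h * ?B)" .
  then show q: "(q oo h) * ?A = 1"
    by (simp only: h fps_const_add[symmetric]) (simp add: algebra_simps del: fps_const_add)
  have "fps_X * (1 - fps_const \<beta> * fps_X) / (1 + fps_const \<alpha> * fps_X) = fps_X * q"
    by (simp add: q_def fps_divide_unit mult.assoc)
  then have "(fps_X * (1 - fps_const \<beta> * fps_X) / (1 + fps_const \<alpha> * fps_X)) oo h = h * (q oo h)"
    by (simp add: fps_compose_mult_distrib[OF h0] h0)
  moreover have "h * (q oo h) * (?B * ?A) = (h * ?B) * ((q oo h) * ?A)"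
    by (simp only: mult_ac)
  ultimately show "((fps_X * (1 - fps_const \<beta> * fps_X) / (1 + fps_const \<alpha> * fps_X)) oo h) *
      (?B * ?A) = fps_X"
    by (simp only: h q mult_1_right)
qed

theorem proposition6:
  fixes \<alpha> \<beta> :: complex
  shows "\<exists>P :: nat \<Rightarrow> complex poly.
    is_coefficient_array
      (infmat_inv (riordan 1 (fps_X / (1 - fps_const \<beta> * fps_X))) \<odot>
       riordan ((1 - fps_const \<beta> * fps_X) / (1 + fps_const \<alpha> * fps_X))
               (fps_X * (1 - fps_const \<beta> * fps_X) / (1 + fps_const \<alpha> * fps_X))) P \<and>
    orthogonal_family P \<and>
    P 0 = 1 \<and>
    P 1 = [:- (\<alpha> + \<beta>), 1:] \<and>
    (\<forall>n\<ge>2. P n = [:- (\<alpha> + 2 * \<beta>), 1:] * P (n - 1) - smult (\<beta> * (\<alpha> + \<beta>)) (P (n - 2)))"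
proof -
  define h where "h = fps_X / (1 - fps_const (- \<beta>) * fps_X)"
  define G where "G = ((1 - fps_const \<beta> * fps_X) / (1 + fps_const \<alpha> * fps_X)) oo h"
  define F where "F = (fps_X * (1 - fps_const \<beta> * fps_X) / (1 + fps_const \<alpha> * fps_X)) oo h"
  let ?M = "infmat_inv (riordan 1 (fps_X / (1 - fps_const \<beta> * fps_X))) \<odot>
       riordan ((1 - fps_const \<beta> * fps_X) / (1 + fps_const \<alpha> * fps_X))
               (fps_X * (1 - fps_const \<beta> * fps_X) / (1 + fps_const \<alpha> * fps_X))"
  have h0: "fps_nth h 0 = 0" by (simp add: h_def fps_divide_unit)
  have M: "?M = riordan G F"
    by (simp only: infmat_inv_riordan_moebius h_def[symmetric] riordan_mult[OF h0]
        G_def[symmetric] F_def[symmetric] mult_1_left)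
  have factor: "1 + fps_const (\<alpha> + 2 * \<beta>) * fps_X + fps_const (\<beta> * (\<alpha> + \<beta>)) * fps_X^2 =
      (1 + fps_const \<beta> * fps_X) * (1 + fps_const (\<alpha> + \<beta>) * fps_X)"
  proof -
    have "fps_const (\<alpha> + 2 * \<beta>) = fps_const \<beta> + fps_const (\<alpha> + \<beta>)"
      by simp
    then show ?thesis
      by (simp only: fps_const_mult[symmetric])
        (simp add: algebra_simps power2_eq_square del: fps_const_add fps_const_mult)
  qed
  have FD: "(1 + fps_const (\<alpha> + 2 * \<beta>) * fps_X + fps_const (\<beta> * (\<alpha> + \<beta>)) * fps_X^2) * F = fps_X"
    unfolding factor F_def h_def using moebius_substitution(2)[of \<beta> \<alpha>] by (simp only: mult_ac)
  have "(1 + fps_const \<beta> * fps_X) * (1 + fps_const (\<alpha> + \<beta>) * fps_X) * G =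
      (1 + fps_const \<beta> * fps_X) * (G * (1 + fps_const (\<alpha> + \<beta>) * fps_X))"
    by (simp only: mult_ac)
  also have "\<dots> = 1 + fps_const \<beta> * fps_X"
    unfolding G_def h_def by (simp only: moebius_substitution(1) mult_1_right)
  finally have GD: "(1 + fps_const (\<alpha> + 2 * \<beta>) * fps_X + fps_const (\<beta> * (\<alpha> + \<beta>)) * fps_X^2) * G =
      1 + fps_const \<beta> * fps_X"
    by (simp only: factor)
  note three_term = row_polynomials_three_term[OF FD GD]
  define P where "P = row_poly (riordan G F)"
  have P0: "P 0 = 1" and P1: "P 1 = [:- (\<alpha> + \<beta>), 1:]"
    using three_term(2,3) by (simp_all add: P_def)
  have rec: "P n = [:- (\<alpha> + 2 * \<beta>), 1:] * P (n - 1) - smult (\<beta> * (\<alpha> + \<beta>)) (P (n - 2))"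
    if "n \<ge> 2" for n
  proof -
    from that obtain m where "n = 2 + m"
      using le_Suc_ex by blast
    then have n: "n = Suc (Suc m)" "n - 1 = Suc m" "n - 2 = m"
      by simp_all
    show ?thesis
      using three_term(4)[of m] unfolding P_def n(2,3) by (simp only: n(1))
  qed
  have "orthogonal_family P"
    unfolding orthogonal_family_def
  proof (intro conjI exI allI impI)
    fix n :: nat assume "n \<ge> 1"
    then show "P n = [:- (if n = 1 then \<alpha> + \<beta> else \<alpha> + 2 * \<beta>), 1:] * P (n - 1)
        - smult (\<beta> * (\<alpha> + \<beta>)) (if n = 1 then 0 else P (n - 2))"
    proof (cases "n = 1")
      case True
      then show ?thesis by (simp add: P0 P1[unfolded One_nat_def])
    next
      case False
      then have "n \<ge> 2" using \<open>n \<ge> 1\<close> by simp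
      from rec[OF this] False show ?thesis by (simp only: if_False)
    qed
  qed (rule P0)
  moreover have "is_coefficient_array ?M P"
    unfolding M is_coefficient_array_def using three_term(1) by (simp add: P_def row_poly_def)
  ultimately show ?thesis
    using P0 P1 rec by (intro exI[of _ P] conjI allI impI)
qed

end
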